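(* Let $f:[0,\infty)\to E^1$ be a continuous fuzzy-number-valued function such that the integral $\int_0^\infty f(x)\,dx$ is Cesàro summable to a fuzzy number $L\in E^1$ and its integral function $s(t)=\int_0^t f(x)\,dx$ is slowly decreasing. Then the integral $\int_0^\infty f(x)\,dx$ converges to $L$.
   Context: A fuzzy number is a function $u:\mathbb{R}\to[0,1]$ that is normal ($u(t)=1$ for some $t$), fuzzy convex ($u(ct+(1-c)t')\ge\min\{u(t),u(t')\}$ for $c\in[0,1]$), upper semicontinuous, and such that $\overline{\{t\in\mathbb{R}:u(t)>0\}}$ is compact. $E^1$ is the set of fuzzy numbers. For $\alpha\in(0,1]$ the level set is $[u]_\alpha=\{t:u(t)\ge\alpha\}$, and $[u]_0=\overline{\{t:u(t)>0\}}$; these are compact intervals written $[u]_\alpha=[u_\alpha^-,u_\alpha^+]$. For $r\in\mathbb{R}$, $\overline{r}\in E^1$ is the indicator function of $\{r\}$. Addition and multiplication by $k\in\mathbb{R}$ are defined levelwise: $[u+v]_\alpha=[u_\alpha^-+v_\alpha^-,u_\alpha^++v_\alpha^+]$ and $[ku]_\alpha=k[u]_\alpha$; $u-\overline{\varepsilon}$ means $u+\overline{-\varepsilon}$. The metric on $E^1$ is $D(u,v)=\sup_{\alpha\in[0,1]}\max\{|u_\alpha^--v_\alpha^-|,|u_\alpha^+-v_\alpha^+|\}$; continuity and limits of $E^1$-valued functions are with respect to $D$. The partial order is: $u\preceq v$ (equivalently $v\succeq u$) iff $u_\alpha^-\le v_\alpha^-$ and $u_\alpha^+\le v_\alpha^+$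 for all $\alpha\in[0,1]$. Integrals of $E^1$-valued functions are fuzzy Riemann integrals: $I\in E^1$ is $\int_a^b f(x)\,dx$ if for each $\varepsilon>0$ there is $\delta>0$ such that every Riemann sum $\sum_i f(\xi_i)(x_{i+1}-x_i)$ over a partition of $[a,b]$ of norm less than $\delta$ with tags $\xi_i\in[x_i,x_{i+1}]$ is at $D$-distance less than $\varepsilon$ from $I$. (For continuous $f$ it exists and $[\int_a^b f]_\alpha=[\int_a^b f_\alpha^-,\int_a^b f_\alpha^+]$, where $[f(x)]_\alpha=[f_\alpha^-(x),f_\alpha^+(x)]$.) The integral $\int_0^\infty f(x)\,dx$ converges to $L\in E^1$ if $\lim_{t\to\infty}\int_0^t f(x)\,dx=L$. For continuous $f:[0,\infty)\to E^1$ and $s(t)=\int_0^t f(x)\,dx$, the Cesàro means are $\sigma(t)=\frac1t\int_0^t s(u)\,du$, $t\in(0,\infty)$. The integral $\int_0^\infty f(x)\,dx$ is Cesàro summable to $L\in E^1$ if $\lim_{t\to\infty}\sigma(t)=L$. A fuzzy-number-valued function $s$ is slowly decreasing if for every $\varepsilon>0$ there exist $t_0\ge 0$ and $\lambda>1$ such that $s(x)\succeq s(t)-\overline{\varepsilon}$ whenever $t_0<t<x\le\lambda t$. *)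

theory Defs
  imports "HOL-Analysis.Analysis"
begin

section \<open>Fuzzy numbers and their level sets\<close>

definition upper_semicontinuous :: "(real \<Rightarrow> real) \<Rightarrow> bool" where
  "upper_semicontinuous u \<longleftrightarrow> (\<forall>x y. u x < y \<longrightarrow> (\<forall>\<^sub>F t in nhds x. u t < y))"

definition is_fuzzy_number :: "(real \<Rightarrow> real) \<Rightarrow> bool" where
  "is_fuzzy_number u \<longleftrightarrow>
     (\<forall>t. 0 \<le> u t \<and> u t \<le> 1) \<and>
     (\<exists>t. u t = 1) \<and>
     (\<forall>t t'. \<forall>c\<in>{0..1}. u (c * t + (1 - c) * t') \<ge> min (u t) (u t')) \<and>
     upper_semicontinuous u \<and>
     compact (closure {t. u t > 0})"

lemma is_fuzzy_numberI:
  assumes rng: "\<And>t. 0 \<le> u t" "\<And>t. u t \<le> 1"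
    and normal: "\<exists>t. u t = 1"
    and closed: "\<And>\<alpha>. 0 < \<alpha> \<Longrightarrow> \<alpha> \<le> 1 \<Longrightarrow> closed {t. u t \<ge> \<alpha>}"
    and conv: "\<And>\<alpha>. 0 < \<alpha> \<Longrightarrow> \<alpha> \<le> 1 \<Longrightarrow> convex {t. u t \<ge> \<alpha>}"
    and supp: "compact (closure {t. u t > 0})"
  shows "is_fuzzy_number u"
  unfolding is_fuzzy_number_def upper_semicontinuous_def
proof (intro conjI allI impI ballI)
  fix t t' c :: real assume c: "c \<in> {0..1}"
  show "u (c * t + (1 - c) * t') \<ge> min (u t) (u t')"
  proof (cases "min (u t) (u t') > 0")
    case True
    have "convex {s. u s \<ge> min (u t) (u t')}"
      using conv True rng(2)[of t] by (simp add: min.coboundedI1)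
    then have "c *\<^sub>R t + (1 - c) *\<^sub>R t' \<in> {s. u s \<ge> min (u t) (u t')}"
      by (rule convexD) (use c in auto)
    then show ?thesis by simp
  next
    case False
    then show ?thesis using rng(1)[of "c * t + (1 - c) * t'"] by linarith
  qed
next
  fix x y assume xy: "u x < y"
  show "\<forall>\<^sub>F t in nhds x. u t < y"
  proof (cases "y \<le> 1")
    case True
    have "y > 0" using xy rng(1)[of x] by linarith
    then have "open (- {t. u t \<ge> y})" using closed True by (simp add: open_Compl)
    then have "\<forall>\<^sub>F t in nhds x. t \<in> - {t. u t \<ge> y}"
      by (rule eventually_nhds_in_open) (use xy in auto)
    then show ?thesis by (simp add: not_le)
  next
    case False
    then show ?thesis using rng(2) by (intro always_eventually) (smt (verit))
  qed
qed (use assms in auto)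

lemma is_fuzzy_number_indicator: "is_fuzzy_number (indicator {r})"
proof (rule is_fuzzy_numberI)
  fix \<alpha> :: real assume "0 < \<alpha>" "\<alpha> \<le> 1"
  then have "{t. \<alpha> \<le> indicator {r} t} = {r}" by (auto simp: indicator_def split: if_splits)
  then show "closed {t. \<alpha> \<le> indicator {r} t}" "convex {t. \<alpha> \<le> indicator {r} t}" by auto
next
  have "{t. (0::real) < indicator {r} t} = {r}" by (auto simp: indicator_def split: if_splits)
  then show "compact (closure {t. (0::real) < indicator {r} t})" by simp
qed (auto simp: indicator_def)

typedef fuzzy_number = "{u. is_fuzzy_number u}"
  morphisms membership Abs_fuzzy_number
  using is_fuzzy_number_indicator by auto

definition crisp :: "real \<Rightarrow> fuzzy_number" where
  "crisp r = Abs_fuzzy_number (indicator {r})"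

definition level :: "fuzzy_number \<Rightarrow> real \<Rightarrow> real set" where
  "level u \<alpha> = (if \<alpha> = 0 then closure {t. membership u t > 0} else {t. membership u t \<ge> \<alpha>})"

text \<open>The endpoints of the level set; see \<open>level_eq_interval\<close>.\<close>

definition lower :: "fuzzy_number \<Rightarrow> real \<Rightarrow> real" where
  "lower u \<alpha> = Inf (level u \<alpha>)"

definition upper :: "fuzzy_number \<Rightarrow> real \<Rightarrow> real" where
  "upper u \<alpha> = Sup (level u \<alpha>)"

lemma is_fuzzy_number_membership: "is_fuzzy_number (membership u)"
  using membership[of u] by simp

lemma membership_bounds: "0 \<le> membership u t" "membership u t \<le> 1"
  using is_fuzzy_number_membership[of u] by (auto simp: is_fuzzy_number_def)

lemma level_antimono:
  assumes "0 \<le> \<alpha>" "\<alpha> \<le> \<beta>"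
  shows "level u \<beta> \<subseteq> level u \<alpha>"
proof (cases "\<alpha> = 0")
  case True
  have "{t. membership u t \<ge> \<beta>} \<subseteq> closure {t. membership u t > 0}" if "\<beta> > 0"
    using that closure_subset[of "{t. membership u t > 0}"] by auto
  then show ?thesis using True assms by (auto simp: level_def)
next
  case False
  then show ?thesis using assms by (auto simp: level_def)
qed

lemma level_nonempty: "\<alpha> \<in> {0..1} \<Longrightarrow> level u \<alpha> \<noteq> {}"
proof -
  assume a: "\<alpha> \<in> {0..1}"
  obtain t where "membership u t = 1"
    using is_fuzzy_number_membership[of u] by (auto simp: is_fuzzy_number_def)
  then have "t \<in> level u 1" by (simp add: level_def)
  then show ?thesis using level_antimono[of \<alpha> 1 u] a by auto
qed

lemma membership_convex_combination:
  assumes "c \<ge> 0" "d \<ge> 0" "c + d = 1"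
  shows "min (membership u t) (membership u t') \<le> membership u (c * t + d * t')"
proof -
  have "d = 1 - c" "c \<in> {0..1}" using assms by auto
  then show ?thesis
    using is_fuzzy_number_membership[of u] by (auto simp: is_fuzzy_number_def)
qed

lemma convex_superlevel_membership:
  shows "convex {t. membership u t > \<alpha>}" "convex {t. membership u t \<ge> \<alpha>}"
proof -
  show "convex {t. membership u t > \<alpha>}"
    unfolding convex_def
    using less_le_trans[OF _ membership_convex_combination] by simp
  show "convex {t. membership u t \<ge> \<alpha>}"
    unfolding convex_def
    using order_trans[OF _ membership_convex_combination] by simp
qed

lemma convex_level: "convex (level u \<alpha>)"
  by (simp add: level_def convex_superlevel_membership)

lemma closed_superlevel_membership: "closed {t. membership u t \<ge> \<alpha>}"
proof -
  have "\<exists>T. open T \<and> x \<in> T \<and> T \<subseteq> {t. membership u t < \<alpha>}" if "membership u x < \<alpha>" for x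
  proof -
    have "\<forall>\<^sub>F t in nhds x. membership u t < \<alpha>"
      using is_fuzzy_number_membership[of u] that
      unfolding is_fuzzy_number_def upper_semicontinuous_def by blast
    then show ?thesis unfolding eventually_nhds by blast
  qed
  then have "open {t. membership u t < \<alpha>}" by (subst open_subopen) simp
  moreover have "- {t. membership u t \<ge> \<alpha>} = {t. membership u t < \<alpha>}" by auto
  ultimately show ?thesis by (simp add: closed_def)
qed

lemma compact_level:
  assumes "0 \<le> \<alpha>"
  shows "compact (level u \<alpha>)"
proof -
  have c0: "compact (level u 0)"
    using is_fuzzy_number_membership[of u] by (simp add: is_fuzzy_number_def level_def)
  have "closed (level u \<alpha>)" by (simp add: level_def closed_superlevel_membership)
  moreover have "level u \<alpha> = level u 0 \<inter> level u \<alpha>"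
    using level_antimono[of 0 \<alpha> u] assms by auto
  ultimately show ?thesis using c0 by (metis compact_Int_closed)
qed

lemma level_eq_interval:
  assumes "\<alpha> \<in> {0..1}"
  shows "level u \<alpha> = {lower u \<alpha>..upper u \<alpha>}"
proof -
  have "connected (level u \<alpha>)" by (simp add: convex_level convex_connected)
  moreover have "compact (level u \<alpha>)" using assms by (simp add: compact_level)
  ultimately obtain a b where ab: "level u \<alpha> = {a..b}"
    using connected_compact_interval_1[of "level u \<alpha>"] by blast
  moreover have "a \<le> b" using ab level_nonempty[OF assms, of u] by auto
  ultimately show ?thesis by (simp add: lower_def upper_def)
qed

lemma lower_le_upper: "\<alpha> \<in> {0..1} \<Longrightarrow> lower u \<alpha> \<le> upper u \<alpha>"
  using level_nonempty[of \<alpha> u] level_eq_interval[of \<alpha> u] by auto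

lemma level_eqI:
  assumes "\<And>\<alpha>. 0 < \<alpha> \<Longrightarrow> \<alpha> \<le> 1 \<Longrightarrow> level u \<alpha> = level v \<alpha>"
  shows "u = v"
proof -
  have "membership u t \<le> membership v t"
    if "\<And>\<alpha>. 0 < \<alpha> \<Longrightarrow> \<alpha> \<le> 1 \<Longrightarrow> level u \<alpha> = level v \<alpha>" for u v t
  proof (cases "membership u t > 0")
    case True
    then have "t \<in> level u (membership u t)" by (simp add: level_def)
    also have "level u (membership u t) = level v (membership u t)"
      using that True membership_bounds by auto
    finally show ?thesis using True by (simp add: level_def)
  next
    case False
    then show ?thesis using membership_bounds(1)[of v t] by linarith
  qed
  from this[OF assms] this[OF assms[symmetric]]
  have "membership u = membership v" by (intro ext antisym) auto
  then show ?thesis by (simp add: membership_inject)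
qed

lemma endpoints_eqI:
  assumes "\<And>\<alpha>. \<alpha> \<in> {0..1} \<Longrightarrow> lower u \<alpha> = lower v \<alpha>"
    and "\<And>\<alpha>. \<alpha> \<in> {0..1} \<Longrightarrow> upper u \<alpha> = upper v \<alpha>"
  shows "u = v"
  by (rule level_eqI) (use assms in \<open>simp add: level_eq_interval\<close>)

lemma level_crisp: "\<alpha> \<in> {0..1} \<Longrightarrow> level (crisp r) \<alpha> = {r}"
proof -
  have m: "membership (crisp r) = indicator {r}"
    by (simp add: crisp_def Abs_fuzzy_number_inverse is_fuzzy_number_indicator)
  have "{t. (0::real) < indicator {r} t} = {r}" by (auto simp: indicator_def split: if_splits)
  moreover have "{t. \<alpha> \<le> indicator {r} t} = {r}" if "\<alpha> > 0" "\<alpha> \<le> 1"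
    using that by (auto simp: indicator_def split: if_splits)
  moreover assume "\<alpha> \<in> {0..1}"
  ultimately show ?thesis by (auto simp: level_def m)
qed

lemma endpoints_crisp [simp]:
  "\<alpha> \<in> {0..1} \<Longrightarrow> lower (crisp r) \<alpha> = r" "\<alpha> \<in> {0..1} \<Longrightarrow> upper (crisp r) \<alpha> = r"
  by (simp_all add: lower_def upper_def level_crisp)

lemma endpoints_le_iff_level_subset:
  assumes "\<alpha> \<in> {0..1}" "level u \<alpha> \<subseteq> {a..b}"
  shows "a \<le> lower u \<alpha>" "upper u \<alpha> \<le> b"
  using assms lower_le_upper[OF assms(1), of u] by (auto simp: level_eq_interval)

lemma endpoints_bounds:
  assumes "\<alpha> \<in> {0..1}"
  shows "lower u 0 \<le> lower u \<alpha>" "upper u \<alpha> \<le> upper u 0"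
  using endpoints_le_iff_level_subset[OF assms, of u "lower u 0" "upper u 0"]
    level_antimono[of 0 \<alpha> u] level_eq_interval[of 0 u] assms by auto


section \<open>Order\<close>

instantiation fuzzy_number :: order
begin

definition less_eq_fuzzy_number :: "fuzzy_number \<Rightarrow> fuzzy_number \<Rightarrow> bool" where
  "u \<le> v \<longleftrightarrow> (\<forall>\<alpha>\<in>{0..1}. lower u \<alpha> \<le> lower v \<alpha> \<and> upper u \<alpha> \<le> upper v \<alpha>)"

definition less_fuzzy_number :: "fuzzy_number \<Rightarrow> fuzzy_number \<Rightarrow> bool" where
  "u < v \<longleftrightarrow> u \<le> v \<and> \<not> v \<le> (u::fuzzy_number)"

instance
proof
  fix u v w :: fuzzy_number
  show "u \<le> w" if "u \<le> v" "v \<le> w"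
    using that unfolding less_eq_fuzzy_number_def by (meson order_trans)
  show "u = v" if "u \<le> v" "v \<le> u"
    using that by (intro endpoints_eqI) (auto simp: less_eq_fuzzy_number_def intro: antisym)
qed (auto simp: less_eq_fuzzy_number_def less_fuzzy_number_def)

end


section \<open>Addition and scalar multiplication\<close>

lemma ex_levelwise_add:
  "\<exists>w. \<forall>\<alpha>\<in>{0..1}. level w \<alpha> = {lower u \<alpha> + lower v \<alpha>..upper u \<alpha> + upper v \<alpha>}"
proof -
  let ?m = "\<lambda>t x. min (membership u x) (membership v (t - x))"
  define w where "w t = (SUP x. ?m t x)" for t
  have m01: "0 \<le> ?m t x" "?m t x \<le> 1" for t x
    using membership_bounds[of u x] membership_bounds[of v "t - x"] by auto
  have bdd: "bdd_above (range (?m t))" for t using m01(2) by (intro bdd_aboveI[of _ 1]) auto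
  have w_ge: "w t \<ge> ?m t x" for t x
    unfolding w_def by (rule cSUP_upper[OF _ bdd]) simp
  have w_le: "w t \<le> 1" for t
    unfolding w_def by (rule cSUP_least) (use m01 in auto)
  have w_0: "w t \<ge> 0" for t using w_ge[of 0 t] m01(1)[of 0 t] by linarith
  have attained: "\<exists>x. ?m t x \<ge> \<alpha>" if a: "0 < \<alpha>" "\<alpha> \<le> w t" for t \<alpha>
  proof -
    define \<beta> where "\<beta> n = \<alpha> * (1 - inverse (real (Suc (Suc n))))" for n
    have \<beta>: "0 < \<beta> n" "\<beta> n < \<alpha>" for n using a by (auto simp: \<beta>_def field_simps add_pos_nonneg)
    define F where "F n = level u (\<beta> n) \<inter> {x. membership v (t - x) \<ge> \<beta> n}" for n
    have F_iff: "x \<in> F n \<longleftrightarrow> ?m t x \<ge> \<beta> n" for x n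
      using \<beta>(1)[of n] by (auto simp: F_def level_def)
    have "\<Inter>(range F) \<noteq> {}"
    proof (rule compact_nest)
      fix n
      have "closed ((\<lambda>x. t - x) -` {s. membership v s \<ge> \<beta> n})"
        by (intro continuous_closed_vimage closed_superlevel_membership continuous_intros)
      then have "closed {x. membership v (t - x) \<ge> \<beta> n}" by (simp add: vimage_def)
      then show "compact (F n)"
        unfolding F_def using \<beta>(1)[of n] by (intro compact_Int_closed compact_level) auto
      have "\<exists>x. \<beta> n < ?m t x"
        using \<beta>(2)[of n] a(2) less_cSUP_iff[of UNIV "?m t" "\<beta> n"] bdd by (auto simp: w_def)
      then show "F n \<noteq> {}" using F_iff by (metis empty_iff less_imp_le)
    next
      fix m n :: nat assume "m \<le> n"
      then have "\<beta> m \<le> \<beta> n" using a(1) by (auto simp: \<beta>_def intro!: mult_left_mono le_imp_inverse_le)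
      then show "F n \<subseteq> F m" using F_iff by (meson order_trans subsetI)
    qed
    then obtain x where "\<And>n. x \<in> F n" by auto
    then have x: "\<beta> n \<le> ?m t x" for n using F_iff by blast
    have "(\<lambda>n. \<alpha> * (1 - inverse (real (Suc (Suc n))))) \<longlonglongrightarrow> \<alpha> * (1 - 0)"
      by (intro tendsto_intros LIMSEQ_Suc[OF LIMSEQ_inverse_real_of_nat])
    then have "\<beta> \<longlonglongrightarrow> \<alpha>" by (simp add: \<beta>_def[abs_def])
    then have "\<alpha> \<le> ?m t x" by (rule LIMSEQ_le_const2) (use x in blast)
    then show ?thesis by blast
  qed
  have sum_interval: "(\<exists>x\<in>{a..b}. t - x \<in> {c..d}) \<longleftrightarrow> t \<in> {a + c..b + d}"
    if "a \<le> b" "c \<le> d" for a b c d t :: real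
  proof
    assume "t \<in> {a + c..b + d}"
    then have "max a (t - d) \<in> {a..b} \<and> t - max a (t - d) \<in> {c..d}" using that by auto
    then show "\<exists>x\<in>{a..b}. t - x \<in> {c..d}" by blast
  qed auto
  have sum_levels: "(\<exists>x\<in>level u \<alpha>. t - x \<in> level v \<alpha>) \<longleftrightarrow>
      t \<in> {lower u \<alpha> + lower v \<alpha>..upper u \<alpha> + upper v \<alpha>}" if "\<alpha> \<in> {0..1}" for \<alpha> t
    unfolding level_eq_interval[OF that]
    by (rule sum_interval[OF lower_le_upper[OF that] lower_le_upper[OF that]])
  have lev: "{t. w t \<ge> \<alpha>} = {lower u \<alpha> + lower v \<alpha>..upper u \<alpha> + upper v \<alpha>}"
    if a: "0 < \<alpha>" "\<alpha> \<le> 1" for \<alpha>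
  proof -
    have "w t \<ge> \<alpha> \<longleftrightarrow> (\<exists>x\<in>level u \<alpha>. t - x \<in> level v \<alpha>)" for t
    proof
      assume "w t \<ge> \<alpha>"
      then show "\<exists>x\<in>level u \<alpha>. t - x \<in> level v \<alpha>" using attained[OF a(1)] a by (auto simp: level_def)
    next
      assume "\<exists>x\<in>level u \<alpha>. t - x \<in> level v \<alpha>"
      then obtain x where "\<alpha> \<le> ?m t x" using a by (auto simp: level_def)
      then show "w t \<ge> \<alpha>" using w_ge[of x t] by linarith
    qed
    then show ?thesis using sum_levels[of \<alpha>] a by (intro set_eqI) simp
  qed
  have supp: "closure {t. w t > 0} = {lower u 0 + lower v 0..upper u 0 + upper v 0}"
  proof -
    let ?U = "{t. membership u t > 0}" and ?V = "{t. membership v t > 0}"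
    have "{t. w t > 0} = ?U + ?V"
    proof (intro set_eqI iffI)
      fix t assume "t \<in> {t. w t > 0}"
      then obtain x where "?m t x \<ge> w t" using attained[of "w t" t] by auto
      with \<open>t \<in> _\<close> have "x \<in> ?U" "t - x \<in> ?V" by auto
      then have "x + (t - x) \<in> ?U + ?V" by (rule set_plus_intro)
      then show "t \<in> ?U + ?V" by simp
    next
      fix t assume "t \<in> ?U + ?V"
      then obtain x y where "x \<in> ?U" "y \<in> ?V" "t = x + y" by (auto elim: set_plus_elim)
      then show "t \<in> {t. w t > 0}" using w_ge[of x t] by auto
    qed
    moreover have "closure (?U + ?V) = closure ?U + closure ?V"
    proof
      have "closed (level u 0 + level v 0)"
      proof -
        have "level u 0 + level v 0 = {x + y |x y. x \<in> level u 0 \<and> y \<in> level v 0}"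
          by (auto simp: set_plus_def)
        then show ?thesis by (simp add: compact_imp_closed compact_sums compact_level)
      qed
      then show "closure (?U + ?V) \<subseteq> closure ?U + closure ?V"
        by (intro closure_minimal set_plus_mono2 closure_subset) (simp add: level_def)
    qed (rule closure_sum)
    moreover have "closure ?U + closure ?V = {lower u 0 + lower v 0..upper u 0 + upper v 0}"
    proof -
      have "t \<in> closure ?U + closure ?V \<longleftrightarrow> (\<exists>x\<in>level u 0. t - x \<in> level v 0)" for t
      proof
        assume "t \<in> closure ?U + closure ?V"
        then obtain x y where "x \<in> closure ?U" "y \<in> closure ?V" "t = x + y" by (rule set_plus_elim)
        then show "\<exists>x\<in>level u 0. t - x \<in> level v 0" by (intro bexI[of _ x]) (simp_all add: level_def)
      next
        assume "\<exists>x\<in>level u 0. t - x \<in> level v 0"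
        then obtain x where "x \<in> closure ?U" "t - x \<in> closure ?V" by (auto simp: level_def)
        then have "x + (t - x) \<in> closure ?U + closure ?V" by (rule set_plus_intro)
        then show "t \<in> closure ?U + closure ?V" by simp
      qed
      then show ?thesis using sum_levels[of 0] by (intro set_eqI) simp
    qed
    ultimately show ?thesis by simp
  qed
  have "is_fuzzy_number w"
  proof (rule is_fuzzy_numberI)
    have "{t. w t \<ge> 1} \<noteq> {}"
      using lev[of 1] lower_le_upper[of 1 u] lower_le_upper[of 1 v] by auto
    then show "\<exists>t. w t = 1" using w_le by (auto intro: antisym)
  qed (use w_0 w_le in \<open>auto simp: lev supp\<close>)
  then have "membership (Abs_fuzzy_number w) = w" by (simp add: Abs_fuzzy_number_inverse)
  then have "\<forall>\<alpha>\<in>{0..1}. level (Abs_fuzzy_number w) \<alpha> = {lower u \<alpha> + lower v \<alpha>..upper u \<alpha> + upper v \<alpha>}"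
    using lev supp by (auto simp: level_def)
  then show ?thesis by blast
qed

lemma ex_levelwise_scale: "\<exists>w. \<forall>\<alpha>\<in>{0..1}. level w \<alpha> = (\<lambda>t. k * t) ` level u \<alpha>"
proof (cases "k = 0")
  case True
  then have "\<forall>\<alpha>\<in>{0..1}. level (crisp 0) \<alpha> = (\<lambda>t. k * t) ` level u \<alpha>"
    using level_nonempty by (simp add: level_crisp image_constant_conv)
  then show ?thesis by blast
next
  case False
  define w where "w t = membership u (t / k)" for t
  have img: "{t. P (t / k)} = (\<lambda>t. k * t) ` {t. P t}" for P
    using False by (auto simp: image_iff intro!: exI[of _ "_ / k"])
  have lev: "{t. w t \<ge> \<alpha>} = (\<lambda>t. k * t) ` {t. membership u t \<ge> \<alpha>}" for \<alpha>
    unfolding w_def by (rule img)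
  have supp: "closure {t. w t > 0} = (\<lambda>t. k * t) ` closure {t. membership u t > 0}"
    unfolding w_def using closure_scaleR[of k "{t. membership u t > 0}"]
    by (subst img) simp
  have "is_fuzzy_number w"
  proof (rule is_fuzzy_numberI)
    obtain t where "membership u t = 1"
      using is_fuzzy_number_membership[of u] by (auto simp: is_fuzzy_number_def)
    then show "\<exists>t. w t = 1" using False by (intro exI[of _ "k * t"]) (simp add: w_def)
    show "closed {t. \<alpha> \<le> w t}" for \<alpha>
      unfolding lev using closed_scaling[OF closed_superlevel_membership[where u = u and \<alpha> = \<alpha>], of k] by simp
    show "convex {t. \<alpha> \<le> w t}" for \<alpha>
      unfolding lev using convex_scaling[OF convex_superlevel_membership(2)[where u = u and \<alpha> = \<alpha>], of k] by simp
    show "compact (closure {t. 0 < w t})"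
      unfolding supp using compact_scaling[OF compact_level[of 0 u], of k] by (simp add: level_def)
  qed (simp_all add: w_def membership_bounds)
  then have "membership (Abs_fuzzy_number w) = w" by (simp add: Abs_fuzzy_number_inverse)
  then have "\<forall>\<alpha>\<in>{0..1}. level (Abs_fuzzy_number w) \<alpha> = (\<lambda>t. k * t) ` level u \<alpha>"
    using lev supp by (auto simp: level_def)
  then show ?thesis by blast
qed

instantiation fuzzy_number :: "{zero, plus, scaleR}"
begin

definition zero_fuzzy_number :: fuzzy_number where
  "0 = crisp 0"

definition plus_fuzzy_number :: "fuzzy_number \<Rightarrow> fuzzy_number \<Rightarrow> fuzzy_number" where
  "u + v = (THE w. \<forall>\<alpha>\<in>{0..1}. level w \<alpha> = {lower u \<alpha> + lower v \<alpha>..upper u \<alpha> + upper v \<alpha>})"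

definition scaleR_fuzzy_number :: "real \<Rightarrow> fuzzy_number \<Rightarrow> fuzzy_number" where
  "k *\<^sub>R u = (THE w. \<forall>\<alpha>\<in>{0..1}. level w \<alpha> = (\<lambda>t. k * t) ` level u \<alpha>)"

instance ..

end

lemma level_add:
  assumes "\<alpha> \<in> {0..1}"
  shows "level (u + v) \<alpha> = {lower u \<alpha> + lower v \<alpha>..upper u \<alpha> + upper v \<alpha>}"
proof -
  have "\<exists>!w. \<forall>\<alpha>\<in>{0..1}. level w \<alpha> = {lower u \<alpha> + lower v \<alpha>..upper u \<alpha> + upper v \<alpha>}"
    using ex_levelwise_add[of u v] by (auto intro!: level_eqI)
  from theI'[OF this] show ?thesis using assms by (simp add: plus_fuzzy_number_def)
qed

lemma level_scaleR:
  assumes "\<alpha> \<in> {0..1}"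
  shows "level (k *\<^sub>R u) \<alpha> = (\<lambda>t. k * t) ` level u \<alpha>"
proof -
  have "\<exists>!w. \<forall>\<alpha>\<in>{0..1}. level w \<alpha> = (\<lambda>t. k * t) ` level u \<alpha>"
    using ex_levelwise_scale[of k u] by (auto intro!: level_eqI)
  from theI'[OF this] show ?thesis using assms by (simp add: scaleR_fuzzy_number_def)
qed

lemma endpoints_add:
  assumes "\<alpha> \<in> {0..1}"
  shows "lower (u + v) \<alpha> = lower u \<alpha> + lower v \<alpha>" "upper (u + v) \<alpha> = upper u \<alpha> + upper v \<alpha>"
  using lower_le_upper[OF assms, of u] lower_le_upper[OF assms, of v]
  unfolding lower_def[of "u + v"] upper_def[of "u + v"] level_add[OF assms] by simp_all

lemma endpoints_scaleR:
  assumes "\<alpha> \<in> {0..1}" "0 \<le> k"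
  shows "lower (k *\<^sub>R u) \<alpha> = k * lower u \<alpha>" "upper (k *\<^sub>R u) \<alpha> = k * upper u \<alpha>"
proof -
  have "level (k *\<^sub>R u) \<alpha> = {k * lower u \<alpha>..k * upper u \<alpha>}"
    unfolding level_scaleR[OF assms(1)] unfolding level_eq_interval[OF assms(1)]
    using assms lower_le_upper[OF assms(1), of u] by (simp add: image_mult_atLeastAtMost_if)
  then show "lower (k *\<^sub>R u) \<alpha> = k * lower u \<alpha>" "upper (k *\<^sub>R u) \<alpha> = k * upper u \<alpha>"
    using assms lower_le_upper[OF assms(1), of u]
    unfolding lower_def[of "k *\<^sub>R u"] upper_def[of "k *\<^sub>R u"] by (simp_all add: mult_left_mono)
qed

instance fuzzy_number :: comm_monoid_add
proof
  fix u v w :: fuzzy_number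
  show "u + v + w = u + (v + w)" "u + v = v + u" "0 + u = u"
    by (rule endpoints_eqI; simp add: endpoints_add zero_fuzzy_number_def)+
qed


section \<open>The metric\<close>

abbreviation endpoint_dist :: "fuzzy_number \<Rightarrow> fuzzy_number \<Rightarrow> real \<Rightarrow> real" where
  "endpoint_dist u v \<alpha> \<equiv> max \<bar>lower u \<alpha> - lower v \<alpha>\<bar> \<bar>upper u \<alpha> - upper v \<alpha>\<bar>"

lemma bdd_above_endpoint_dist: "bdd_above (endpoint_dist u v ` {0..1})"
proof (rule bdd_aboveI2)
  fix \<alpha> :: real assume a: "\<alpha> \<in> {0..1}"
  show "endpoint_dist u v \<alpha> \<le> \<bar>lower u 0\<bar> + \<bar>upper u 0\<bar> + \<bar>lower v 0\<bar> + \<bar>upper v 0\<bar>"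
    using endpoints_bounds[OF a, of u] endpoints_bounds[OF a, of v]
      lower_le_upper[OF a, of u] lower_le_upper[OF a, of v] by linarith
qed

instantiation fuzzy_number :: metric_space
begin

definition dist_fuzzy_number :: "fuzzy_number \<Rightarrow> fuzzy_number \<Rightarrow> real" where
  "dist u v = (SUP \<alpha>\<in>{0..1}. max \<bar>lower u \<alpha> - lower v \<alpha>\<bar> \<bar>upper u \<alpha> - upper v \<alpha>\<bar>)"

definition uniformity_fuzzy_number :: "(fuzzy_number \<times> fuzzy_number) filter" where
  "uniformity_fuzzy_number = (INF e\<in>{0<..}. principal {(u, v). dist u v < e})"

definition open_fuzzy_number :: "fuzzy_number set \<Rightarrow> bool" where
  "open_fuzzy_number U \<longleftrightarrow> (\<forall>u\<in>U. \<forall>\<^sub>F (u', v) in uniformity. u' = u \<longrightarrow> v \<in> U)"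

instance
proof
  fix u v w :: fuzzy_number
  have ge: "endpoint_dist u v \<alpha> \<le> dist u v" if "\<alpha> \<in> {0..1}" for \<alpha> u v
    unfolding dist_fuzzy_number_def by (rule cSUP_upper[OF that bdd_above_endpoint_dist])
  show "dist u v = 0 \<longleftrightarrow> u = v"
  proof
    assume "dist u v = 0"
    then have "endpoint_dist u v \<alpha> \<le> 0" if "\<alpha> \<in> {0..1}" for \<alpha> using ge[OF that, of u v] by simp
    then have "lower u \<alpha> = lower v \<alpha> \<and> upper u \<alpha> = upper v \<alpha>" if "\<alpha> \<in> {0..1}" for \<alpha>
      using that by fastforce
    then show "u = v" by (blast intro: endpoints_eqI)
  qed (simp add: dist_fuzzy_number_def)
  show "dist u v \<le> dist u w + dist v w"
    unfolding dist_fuzzy_number_def[of u v]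
  proof (rule cSUP_least)
    fix \<alpha> :: real assume a: "\<alpha> \<in> {0..1}"
    show "endpoint_dist u v \<alpha> \<le> dist u w + dist v w"
      using ge[OF a, of u w] ge[OF a, of v w] by linarith
  qed simp
qed (simp_all add: uniformity_fuzzy_number_def open_fuzzy_number_def)

end


section \<open>The fuzzy Riemann integral\<close>

text \<open>Meant for \<open>a \<le> b\<close>. For \<open>a = b\<close> the only partition is the trivial one \<open>n = 0\<close>, so the
  integral is \<open>0\<close>.\<close>

definition has_fuzzy_integral ::
  "(real \<Rightarrow> fuzzy_number) \<Rightarrow> fuzzy_number \<Rightarrow> real \<Rightarrow> real \<Rightarrow> bool" where
  "has_fuzzy_integral f I a b \<longleftrightarrow>
     (\<forall>\<epsilon>>0. \<exists>\<delta>>0. \<forall>(n::nat) (x :: nat \<Rightarrow> real) (\<xi> :: nat \<Rightarrow> real).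
        x 0 = a \<and> x n = b \<and>
        (\<forall>i<n. x i < x (Suc i) \<and> x (Suc i) - x i < \<delta> \<and> \<xi> i \<in> {x i..x (Suc i)}) \<longrightarrow>
        dist (\<Sum>i<n. (x (Suc i) - x i) *\<^sub>R f (\<xi> i)) I < \<epsilon>)"

lemma has_fuzzy_integral_unique:
  assumes "a \<le> b" "has_fuzzy_integral f I a b" "has_fuzzy_integral f J a b"
  shows "I = J"
proof (rule ccontr)
  assume "I \<noteq> J"
  then have e: "dist I J / 2 > 0" by simp
  define tagged where "tagged \<delta> n x \<xi> \<longleftrightarrow> x 0 = a \<and> x n = b \<and>
      (\<forall>i<n. x i < x (Suc i) \<and> x (Suc i) - x i < \<delta> \<and> \<xi> i \<in> {x i..x (Suc i)})"
    for \<delta> and n :: nat and x \<xi> :: "nat \<Rightarrow> real"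
  define RS where "RS n x \<xi> = (\<Sum>i<n. (x (Suc i) - x i) *\<^sub>R f (\<xi> i))"
    for n :: nat and x \<xi> :: "nat \<Rightarrow> real"
  have fine: "\<exists>\<delta>>0. \<forall>n x \<xi>. tagged \<delta> n x \<xi> \<longrightarrow> dist (RS n x \<xi>) K < dist I J / 2"
    if "has_fuzzy_integral f K a b" for K
    using that e unfolding has_fuzzy_integral_def tagged_def RS_def by (elim allE impE)
  obtain \<delta>1 where d1: "\<delta>1 > 0" "\<And>n x \<xi>. tagged \<delta>1 n x \<xi> \<Longrightarrow> dist (RS n x \<xi>) I < dist I J / 2"
    using fine[OF assms(2)] by blast
  obtain \<delta>2 where d2: "\<delta>2 > 0" "\<And>n x \<xi>. tagged \<delta>2 n x \<xi> \<Longrightarrow> dist (RS n x \<xi>) J < dist I J / 2"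
    using fine[OF assms(3)] by blast
  define \<delta> where "\<delta> = min \<delta>1 \<delta>2"
  have \<delta>: "\<delta> > 0" using d1(1) d2(1) by (simp add: \<delta>_def)
  have "\<exists>n x \<xi>. tagged \<delta> n x \<xi>"
  proof (cases "a = b")
    case True
    then have "tagged \<delta> 0 (\<lambda>_. a) (\<lambda>_. a)" by (simp add: tagged_def)
    then show ?thesis by blast
  next
    case False
    then have ab: "b - a > 0" using assms(1) by simp
    obtain n :: nat where n: "(b - a) / \<delta> < real n" using reals_Archimedean2 by blast
    then have n0: "real n > 0" using ab \<delta> by (meson divide_pos_pos less_trans)
    define h where "h = (b - a) / real n"
    have h: "0 < h" "h < \<delta>" using n n0 ab \<delta> by (simp_all add: h_def field_simps)
    define x where "x i = a + real i * h" for i :: nat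
    have "x 0 = a" by (simp add: x_def)
    moreover have "x n = b" using n0 by (simp add: x_def h_def)
    moreover have "x (Suc i) = x i + h" for i by (simp add: x_def algebra_simps)
    ultimately have "tagged \<delta> n x x" using h by (simp add: tagged_def)
    then show ?thesis by blast
  qed
  then obtain n x \<xi> where "tagged \<delta> n x \<xi>" by blast
  then have "tagged \<delta>1 n x \<xi>" "tagged \<delta>2 n x \<xi>" by (auto simp: tagged_def \<delta>_def)
  then have "dist (RS n x \<xi>) I < dist I J / 2" "dist (RS n x \<xi>) J < dist I J / 2"
    using d1(2) d2(2) by blast+
  then have "dist I J < dist I J" using dist_triangle_half_r by blast
  then show False by simp
qed

text \<open>Unspecified if \<open>f\<close> is not integrable; continuous functions are integrable.\<close>

definition fuzzy_integral :: "real \<Rightarrow> real \<Rightarrow> (real \<Rightarrow> fuzzy_number) \<Rightarrow> fuzzy_number" where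
  "fuzzy_integral a b f = (THE I. has_fuzzy_integral f I a b)"

lemma fuzzy_integral_eqI:
  "a \<le> b \<Longrightarrow> has_fuzzy_integral f I a b \<Longrightarrow> fuzzy_integral a b f = I"
  unfolding fuzzy_integral_def by (blast intro: has_fuzzy_integral_unique)


section \<open>Improper integrals, Cesaro summability, slow decrease\<close>

definition integral_function :: "(real \<Rightarrow> fuzzy_number) \<Rightarrow> real \<Rightarrow> fuzzy_number" where
  "integral_function f t = fuzzy_integral 0 t f"

definition integral_converges_to :: "(real \<Rightarrow> fuzzy_number) \<Rightarrow> fuzzy_number \<Rightarrow> bool" where
  "integral_converges_to f L \<longleftrightarrow> (integral_function f \<longlongrightarrow> L) at_top"

definition cesaro_mean :: "(real \<Rightarrow> fuzzy_number) \<Rightarrow> real \<Rightarrow> fuzzy_number" where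
  "cesaro_mean f t = (1 / t) *\<^sub>R fuzzy_integral 0 t (integral_function f)"

definition cesaro_summable_to :: "(real \<Rightarrow> fuzzy_number) \<Rightarrow> fuzzy_number \<Rightarrow> bool" where
  "cesaro_summable_to f L \<longleftrightarrow> (cesaro_mean f \<longlongrightarrow> L) at_top"

definition slowly_decreasing :: "(real \<Rightarrow> fuzzy_number) \<Rightarrow> bool" where
  "slowly_decreasing s \<longleftrightarrow>
     (\<forall>\<epsilon>>0. \<exists>t\<^sub>0\<ge>0. \<exists>c>1. \<forall>t x. t\<^sub>0 < t \<and> t < x \<and> x \<le> c * t \<longrightarrow> s x \<ge> s t + crisp (- \<epsilon>))"

end

theory Submission
  imports Defs
begin

text \<open>
  Both endpoint functions of the integral of a continuous \<open>f\<close> are the ordinary integrals of the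
  endpoint functions of \<open>f\<close>. With \<open>c > 1\<close>, the number \<open>(c\<sigma>(ct) - \<sigma>(t)) / (c - 1)\<close> is the average
  of \<open>s\<close> over \<open>[t, ct]\<close>, and it is close to \<open>L\<close> when \<open>\<sigma>\<close> is. Slow decrease bounds \<open>s(t)\<close> from above
  by the average over \<open>[t, ct]\<close> and from below by the average over \<open>[t/c, t]\<close>, up to \<open>\<epsilon>\<close>. All bounds
  are uniform in the level \<open>\<alpha>\<close>, so they give convergence in \<open>D\<close>.
\<close>

section \<open>Endpoint functions\<close>

lemma abs_endpoint_diff_le_dist:
  assumes "\<alpha> \<in> {0..1}"
  shows "\<bar>lower u \<alpha> - lower v \<alpha>\<bar> \<le> dist u v" "\<bar>upper u \<alpha> - upper v \<alpha>\<bar> \<le> dist u v"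
proof -
  have "endpoint_dist u v \<alpha> \<le> dist u v"
    unfolding dist_fuzzy_number_def by (rule cSUP_upper[OF assms bdd_above_endpoint_dist])
  then show "\<bar>lower u \<alpha> - lower v \<alpha>\<bar> \<le> dist u v" "\<bar>upper u \<alpha> - upper v \<alpha>\<bar> \<le> dist u v"
    by auto
qed

lemma dist_fuzzy_number_leI:
  assumes "\<And>\<alpha>. \<alpha> \<in> {0..1} \<Longrightarrow> \<bar>lower u \<alpha> - lower v \<alpha>\<bar> \<le> e"
    and "\<And>\<alpha>. \<alpha> \<in> {0..1} \<Longrightarrow> \<bar>upper u \<alpha> - upper v \<alpha>\<bar> \<le> e"
  shows "dist u v \<le> e"
  unfolding dist_fuzzy_number_def by (rule cSUP_least) (use assms in auto)

section \<open>Properties that characterise endpoint functions\<close>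

lemma endpoints_mono:
  assumes "0 \<le> \<beta>" "\<beta> \<le> \<alpha>" "\<alpha> \<le> 1"
  shows "lower u \<beta> \<le> lower u \<alpha>" "upper u \<alpha> \<le> upper u \<beta>"
  using endpoints_le_iff_level_subset[of \<alpha> u "lower u \<beta>" "upper u \<beta>"]
    level_antimono[of \<beta> \<alpha> u] level_eq_interval[of \<beta> u] assms by auto

text \<open>A point lying in all level sets with 0 < \<beta> < \<alpha> has membership at least
  every such \<beta>, hence at least \<alpha>. So a positive level set is the intersection of the
  positive levels below it; this is left continuity in order form.\<close>

lemma endpoints_left_continuous:
  assumes \<alpha>: "0 < \<alpha>" "\<alpha> \<le> 1"
  shows "(\<And>\<beta>. 0 < \<beta> \<Longrightarrow> \<beta> < \<alpha> \<Longrightarrow> lower u \<beta> \<le> x) \<Longrightarrow> lower u \<alpha> \<le> x"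
    and "(\<And>\<beta>. 0 < \<beta> \<Longrightarrow> \<beta> < \<alpha> \<Longrightarrow> x \<le> upper u \<beta>) \<Longrightarrow> x \<le> upper u \<alpha>"
proof -
  have mem: "y \<in> {lower u \<alpha>..upper u \<alpha>}"
    if y: "\<And>\<beta>. 0 < \<beta> \<Longrightarrow> \<beta> < \<alpha> \<Longrightarrow> y \<in> {lower u \<beta>..upper u \<beta>}" for y
  proof -
    have "\<beta> \<le> membership u y" if "0 < \<beta>" "\<beta> < \<alpha>" for \<beta>
    proof -
      have "y \<in> level u \<beta>" using level_eq_interval[of \<beta> u] y[OF that] that \<alpha> by auto
      then show ?thesis using that by (simp add: level_def)
    qed
    then have "\<alpha> \<le> membership u y" using \<alpha>(1) by (rule dense_le_bounded[rotated])
    then have "y \<in> level u \<alpha>" using \<alpha> by (simp add: level_def)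
    then show ?thesis using level_eq_interval[of \<alpha> u] \<alpha> by auto
  qed
  have lu: "lower u \<alpha> \<le> upper u \<alpha>" using lower_le_upper \<alpha> by simp
  show "lower u \<alpha> \<le> x" if "\<And>\<beta>. 0 < \<beta> \<Longrightarrow> \<beta> < \<alpha> \<Longrightarrow> lower u \<beta> \<le> x"
  proof -
    \<comment> \<open>The bound x itself may lie to the right of \<open>upper u \<beta>\<close>.
      Capping it at \<open>lower u \<alpha>\<close> keeps the point inside every interval at a level
      \<beta> < \<alpha>.\<close>
    have "min x (lower u \<alpha>) \<in> {lower u \<alpha>..upper u \<alpha>}"
    proof (rule mem)
      fix \<beta> assume "0 < \<beta>" "\<beta> < \<alpha>"
      then show "min x (lower u \<alpha>) \<in> {lower u \<beta>..upper u \<beta>}"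
        using that[of \<beta>] endpoints_mono[of \<beta> \<alpha> u] \<alpha> lu by auto
    qed
    then show ?thesis by auto
  qed
  show "x \<le> upper u \<alpha>" if "\<And>\<beta>. 0 < \<beta> \<Longrightarrow> \<beta> < \<alpha> \<Longrightarrow> x \<le> upper u \<beta>"
  proof -
    have "max x (upper u \<alpha>) \<in> {lower u \<alpha>..upper u \<alpha>}"
    proof (rule mem)
      fix \<beta> assume "0 < \<beta>" "\<beta> < \<alpha>"
      then show "max x (upper u \<alpha>) \<in> {lower u \<beta>..upper u \<beta>}"
        using that[of \<beta>] endpoints_mono[of \<beta> \<alpha> u] \<alpha> lu by auto
    qed
    then show ?thesis by auto
  qed
qed

text \<open>The level at 0 is the closure of the union of the positive levels, so a closed set
  containing all of these contains it. If the conclusion failed, a closed half-line would be such a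
  set and yet miss an endpoint at level 0.\<close>

lemma endpoints_right_continuous_0:
  shows "lower u 0 < x \<Longrightarrow> \<exists>\<beta>. 0 < \<beta> \<and> \<beta> \<le> 1 \<and> lower u \<beta> < x"
    and "x < upper u 0 \<Longrightarrow> \<exists>\<beta>. 0 < \<beta> \<and> \<beta> \<le> 1 \<and> x < upper u \<beta>"
proof -
  have sub: "level u 0 \<subseteq> T" if T: "closed T" "\<And>\<beta>. 0 < \<beta> \<Longrightarrow> \<beta> \<le> 1 \<Longrightarrow> level u \<beta> \<subseteq> T" for T
  proof -
    have "t \<in> T" if "membership u t > 0" for t
      using T(2)[of "membership u t"] that membership_bounds[of u t]
      by (auto simp: level_def)
    then have "closure {t. membership u t > 0} \<subseteq> T" using T(1) by (intro closure_minimal) auto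
    then show ?thesis by (simp add: level_def)
  qed
  have ends: "lower u 0 \<in> level u 0" "upper u 0 \<in> level u 0"
    using level_eq_interval[of 0 u] lower_le_upper[of 0 u] by auto
  show "\<exists>\<beta>. 0 < \<beta> \<and> \<beta> \<le> 1 \<and> lower u \<beta> < x" if "lower u 0 < x"
  proof (rule ccontr)
    assume "\<not> ?thesis"
    then have "x \<le> lower u \<beta>" if "0 < \<beta>" "\<beta> \<le> 1" for \<beta> using that by force
    then have "level u 0 \<subseteq> {x..}" by (intro sub) (force simp: level_eq_interval)+
    then show False using ends that by auto
  qed
  show "\<exists>\<beta>. 0 < \<beta> \<and> \<beta> \<le> 1 \<and> x < upper u \<beta>" if "x < upper u 0"
  proof (rule ccontr)
    assume "\<not> ?thesis"
    then have "upper u \<beta> \<le> x" if "0 < \<beta>" "\<beta> \<le> 1" for \<beta> using that by force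
    then have "level u 0 \<subseteq> {..x}" by (intro sub) (force simp: level_eq_interval)+
    then show False using ends that by auto
  qed
qed

text \<open>The last four hypotheses are left continuity on \<open>(0,1]\<close> and right continuity at \<open>0\<close>, in the
  order form these take for monotone functions.\<close>

lemma ex_fuzzy_number_endpoints:
  fixes l r :: "real \<Rightarrow> real"
  assumes mono: "\<And>\<alpha> \<beta>. 0 \<le> \<beta> \<Longrightarrow> \<beta> \<le> \<alpha> \<Longrightarrow> \<alpha> \<le> 1 \<Longrightarrow> l \<beta> \<le> l \<alpha> \<and> r \<alpha> \<le> r \<beta>"
    and le: "l 1 \<le> r 1"
    and left_l: "\<And>\<alpha> x. 0 < \<alpha> \<Longrightarrow> \<alpha> \<le> 1 \<Longrightarrow> (\<And>\<beta>. 0 < \<beta> \<Longrightarrow> \<beta> < \<alpha> \<Longrightarrow> l \<beta> \<le> x) \<Longrightarrow> l \<alpha> \<le> x"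
    and left_r: "\<And>\<alpha> x. 0 < \<alpha> \<Longrightarrow> \<alpha> \<le> 1 \<Longrightarrow> (\<And>\<beta>. 0 < \<beta> \<Longrightarrow> \<beta> < \<alpha> \<Longrightarrow> x \<le> r \<beta>) \<Longrightarrow> x \<le> r \<alpha>"
    and right_l: "\<And>x. l 0 < x \<Longrightarrow> \<exists>\<beta>. 0 < \<beta> \<and> \<beta> \<le> 1 \<and> l \<beta> < x"
    and right_r: "\<And>x. x < r 0 \<Longrightarrow> \<exists>\<beta>. 0 < \<beta> \<and> \<beta> \<le> 1 \<and> x < r \<beta>"
  shows "\<exists>u. \<forall>\<alpha>\<in>{0..1}. lower u \<alpha> = l \<alpha> \<and> upper u \<alpha> = r \<alpha>"
proof -
  \<comment> \<open>\<open>w t\<close> is to be the largest level whose interval contains t.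
    Inserting 0 gives \<open>w t\<close> = 0 outside all intervals, instead of the supremum of an
    empty set.\<close>
  define A where "A t = insert 0 {\<alpha>. 0 \<le> \<alpha> \<and> \<alpha> \<le> 1 \<and> l \<alpha> \<le> t \<and> t \<le> r \<alpha>}" for t
  define w where "w t = Sup (A t)" for t
  have bdd: "bdd_above (A t)" for t by (rule bdd_aboveI[of _ 1]) (auto simp: A_def)
  have w_ge: "\<alpha> \<le> w t" if "\<alpha> \<in> A t" for \<alpha> t
    unfolding w_def by (rule cSup_upper[OF that bdd])
  have w0: "0 \<le> w t" for t by (rule w_ge) (simp add: A_def)
  have w1: "w t \<le> 1" for t unfolding w_def by (rule cSup_least) (auto simp: A_def)
  have gt: "\<exists>\<gamma>. \<beta> < \<gamma> \<and> \<gamma> \<le> 1 \<and> l \<gamma> \<le> t \<and> t \<le> r \<gamma>" if "0 \<le> \<beta>" "\<beta> < w t" for \<beta> t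
  proof -
    have "\<exists>\<gamma>\<in>A t. \<beta> < \<gamma>"
      using that less_cSup_iff[OF _ bdd, of t \<beta>] by (auto simp: w_def A_def)
    then show ?thesis using that by (auto simp: A_def)
  qed
  have lev: "{t. \<alpha> \<le> w t} = {l \<alpha>..r \<alpha>}" if \<alpha>: "0 < \<alpha>" "\<alpha> \<le> 1" for \<alpha>
  proof (intro set_eqI iffI)
    fix t assume "t \<in> {l \<alpha>..r \<alpha>}"
    then have "\<alpha> \<in> A t" using \<alpha> by (simp add: A_def)
    then show "t \<in> {t. \<alpha> \<le> w t}" using w_ge by simp
  next
    fix t assume "t \<in> {t. \<alpha> \<le> w t}"
    then have t: "\<alpha> \<le> w t" by simp
    \<comment> \<open>The supremum only supplies a level \<gamma> above each \<beta> < \<alpha>.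
      Nestedness brings t down to level \<beta>, and left continuity then reaches \<alpha>
      itself.\<close>
    have *: "l \<beta> \<le> t \<and> t \<le> r \<beta>" if \<beta>: "0 < \<beta>" "\<beta> < \<alpha>" for \<beta>
    proof -
      obtain \<gamma> where "\<beta> < \<gamma>" "\<gamma> \<le> 1" "l \<gamma> \<le> t" "t \<le> r \<gamma>" using gt[of \<beta> t] \<beta> t by auto
      then show ?thesis using mono[of \<beta> \<gamma>] \<beta> by auto
    qed
    have "l \<alpha> \<le> t" by (rule left_l[OF \<alpha>]) (use * in blast)
    moreover have "t \<le> r \<alpha>" by (rule left_r[OF \<alpha>]) (use * in blast)
    ultimately show "t \<in> {l \<alpha>..r \<alpha>}" by simp
  qed
  have supp: "closure {t. 0 < w t} = {l 0..r 0}"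
  proof
    show "closure {t. 0 < w t} \<subseteq> {l 0..r 0}"
    proof (rule closure_minimal)
      show "{t. 0 < w t} \<subseteq> {l 0..r 0}"
      proof
        fix t assume "t \<in> {t. 0 < w t}"
        then obtain \<gamma> where "0 < \<gamma>" "\<gamma> \<le> 1" "l \<gamma> \<le> t" "t \<le> r \<gamma>" using gt[of 0 t] by auto
        then show "t \<in> {l 0..r 0}" using mono[of 0 \<gamma>] by auto
      qed
    qed simp
    \<comment> \<open>Right continuity at 0 enters here: each point strictly between the endpoints
      at level 0 lies in the interval of some positive level.\<close>
    have pos: "{l 0<..<r 0} \<subseteq> {t. 0 < w t}"
    proof
      fix t assume "t \<in> {l 0<..<r 0}"
      then obtain \<beta> \<gamma> where *: "0 < \<beta>" "\<beta> \<le> 1" "l \<beta> < t" "0 < \<gamma>" "\<gamma> \<le> 1" "t < r \<gamma>"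
        using right_l[of t] right_r[of t] by auto
      then have "min \<beta> \<gamma> \<in> A t"
        using mono[of "min \<beta> \<gamma>" \<beta>] mono[of "min \<beta> \<gamma>" \<gamma>] by (auto simp: A_def)
      from w_ge[OF this] show "t \<in> {t. 0 < w t}" using * by auto
    qed
    have "l 1 \<in> {t. 1 \<le> w t}" using lev[of 1] le by auto
    then have l1: "0 < w (l 1)" by simp
    show "{l 0..r 0} \<subseteq> closure {t. 0 < w t}"
    proof (cases "l 0 < r 0")
      case True
      then show ?thesis using closure_mono[OF pos] by simp
    next
      \<comment> \<open>The open interval is empty here, but then all intervals collapse to the
        point \<open>l 1\<close>, where w is positive.\<close>
      case False
      then have "{l 0..r 0} \<subseteq> {l 1}" using mono[of 0 1] le by auto
      then show ?thesis using l1 closure_subset[of "{t. 0 < w t}"] by auto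
    qed
  qed
  have "is_fuzzy_number w"
  proof (rule is_fuzzy_numberI)
    have "1 \<le> w (l 1)" using lev[of 1] le by auto
    then show "\<exists>t. w t = 1" using w1 by (auto intro: antisym)
  qed (use w0 w1 in \<open>auto simp: lev supp\<close>)
  then have m: "membership (Abs_fuzzy_number w) = w" by (simp add: Abs_fuzzy_number_inverse)
  have "level (Abs_fuzzy_number w) \<alpha> = {l \<alpha>..r \<alpha>}" if "\<alpha> \<in> {0..1}" for \<alpha>
    using that lev supp m by (auto simp: level_def)
  moreover have "l \<alpha> \<le> r \<alpha>" if "\<alpha> \<in> {0..1}" for \<alpha> using mono[of \<alpha> 1] le that by auto
  ultimately have "\<forall>\<alpha>\<in>{0..1}. lower (Abs_fuzzy_number w) \<alpha> = l \<alpha> \<and> upper (Abs_fuzzy_number w) \<alpha> = r \<alpha>"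
    by (simp add: lower_def upper_def)
  then show ?thesis by blast
qed

text \<open>This is completeness of the space of fuzzy numbers in endpoint form. Monotonicity,
  \<open>l 1 \<le> r 1\<close> and the one-sided continuity conditions are order statements, and
  each survives errors that are small uniformly in the level.\<close>

lemma ex_fuzzy_number_uniform_limit:
  fixes l r :: "real \<Rightarrow> real"
  assumes approx: "\<And>e. e > 0 \<Longrightarrow>
    \<exists>u. \<forall>\<alpha>\<in>{0..1}. \<bar>lower u \<alpha> - l \<alpha>\<bar> \<le> e \<and> \<bar>upper u \<alpha> - r \<alpha>\<bar> \<le> e"
  shows "\<exists>u. \<forall>\<alpha>\<in>{0..1}. lower u \<alpha> = l \<alpha> \<and> upper u \<alpha> = r \<alpha>"
proof -
  obtain U where U: "\<bar>lower (U e) \<alpha> - l \<alpha>\<bar> \<le> e \<and> \<bar>upper (U e) \<alpha> - r \<alpha>\<bar> \<le> e"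
    if "e > 0" "0 \<le> \<alpha>" "\<alpha> \<le> 1" for e \<alpha>
    using approx by (metis atLeastAtMost_iff)
  have le_approx: "x \<le> y" if "\<And>e. e > 0 \<Longrightarrow> x \<le> y + 2 * e" for x y :: real
  proof (rule field_le_epsilon)
    fix e :: real assume "e > 0" then show "x \<le> y + e" using that[of "e/2"] by simp
  qed
  show ?thesis
  proof (rule ex_fuzzy_number_endpoints)
    show "l \<beta> \<le> l \<alpha> \<and> r \<alpha> \<le> r \<beta>" if "0 \<le> \<beta>" "\<beta> \<le> \<alpha>" "\<alpha> \<le> 1" for \<alpha> \<beta>
    proof (intro conjI; rule le_approx)
      fix e :: real assume "e > 0"
      note u = U[OF this]
      show "l \<beta> \<le> l \<alpha> + 2 * e" "r \<alpha> \<le> r \<beta> + 2 * e"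
        using u[of \<alpha>] u[of \<beta>] endpoints_mono[OF that, of "U e"] that by auto
    qed
    show "l 1 \<le> r 1"
    proof (rule le_approx)
      fix e :: real assume "e > 0"
      note u = U[OF this]
      show "l 1 \<le> r 1 + 2 * e" using u[of 1] lower_le_upper[of 1 "U e"] by auto
    qed
    show "l \<alpha> \<le> x" if \<alpha>: "0 < \<alpha>" "\<alpha> \<le> 1" and x: "\<And>\<beta>. 0 < \<beta> \<Longrightarrow> \<beta> < \<alpha> \<Longrightarrow> l \<beta> \<le> x" for \<alpha> x
    proof (rule le_approx)
      fix e :: real assume "e > 0"
      note u = U[OF this]
      have "lower (U e) \<alpha> \<le> x + e"
      proof (rule endpoints_left_continuous(1)[OF \<alpha>])
        fix \<beta> assume "0 < \<beta>" "\<beta> < \<alpha>"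
        then show "lower (U e) \<beta> \<le> x + e" using u[of \<beta>] x[of \<beta>] \<alpha> by auto
      qed
      then show "l \<alpha> \<le> x + 2 * e" using u[of \<alpha>] \<alpha> by auto
    qed
    show "x \<le> r \<alpha>" if \<alpha>: "0 < \<alpha>" "\<alpha> \<le> 1" and x: "\<And>\<beta>. 0 < \<beta> \<Longrightarrow> \<beta> < \<alpha> \<Longrightarrow> x \<le> r \<beta>" for \<alpha> x
    proof (rule le_approx)
      fix e :: real assume "e > 0"
      note u = U[OF this]
      have "x - e \<le> upper (U e) \<alpha>"
      proof (rule endpoints_left_continuous(2)[OF \<alpha>])
        fix \<beta> assume "0 < \<beta>" "\<beta> < \<alpha>"
        then show "x - e \<le> upper (U e) \<beta>" using u[of \<beta>] x[of \<beta>] \<alpha> by auto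
      qed
      then show "x \<le> r \<alpha> + 2 * e" using u[of \<alpha>] \<alpha> by auto
    qed
    show "\<exists>\<beta>. 0 < \<beta> \<and> \<beta> \<le> 1 \<and> l \<beta> < x" if "l 0 < x" for x
    proof -
      \<comment> \<open>One third of the gap covers the error at level 0, another the error at level
        \<beta>; the last keeps the inequality for \<open>U e\<close> strict.\<close>
      define e where "e = (x - l 0) / 3"
      have e: "e > 0" "x = l 0 + 3 * e" using that by (simp_all add: e_def field_simps)
      note u = U[OF e(1)]
      have "lower (U e) 0 < x - e" using u[of 0] e by auto
      from endpoints_right_continuous_0(1)[OF this]
      obtain \<beta> where \<beta>: "0 < \<beta>" "\<beta> \<le> 1" "lower (U e) \<beta> < x - e" by blast
      then have "l \<beta> < x" using u[of \<beta>] by auto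
      then show ?thesis using \<beta> by blast
    qed
    show "\<exists>\<beta>. 0 < \<beta> \<and> \<beta> \<le> 1 \<and> x < r \<beta>" if "x < r 0" for x
    proof -
      define e where "e = (r 0 - x) / 3"
      have e: "e > 0" "x = r 0 - 3 * e" using that by (simp_all add: e_def field_simps)
      note u = U[OF e(1)]
      have "x + e < upper (U e) 0" using u[of 0] e by auto
      from endpoints_right_continuous_0(2)[OF this]
      obtain \<beta> where \<beta>: "0 < \<beta>" "\<beta> \<le> 1" "x + e < upper (U e) \<beta>" by blast
      then have "x < r \<beta>" using u[of \<beta>] by auto
      then show ?thesis using \<beta> by blast
    qed
  qed
qed

lemma continuous_on_endpoints:
  assumes "continuous_on S f" "\<alpha> \<in> {0..1}"
  shows "continuous_on S (\<lambda>x. lower (f x) \<alpha>)" "continuous_on S (\<lambda>x. upper (f x) \<alpha>)"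
proof -
  have "1-lipschitz_on UNIV (\<lambda>u. lower u \<alpha>)" "1-lipschitz_on UNIV (\<lambda>u. upper u \<alpha>)"
    using abs_endpoint_diff_le_dist[OF assms(2)] by (auto intro!: lipschitz_onI simp: dist_real_def)
  then have "continuous_on UNIV (\<lambda>u. lower u \<alpha>)" "continuous_on UNIV (\<lambda>u. upper u \<alpha>)"
    by (auto intro: lipschitz_on_continuous_on)
  from this[THEN continuous_on_compose2, OF assms(1)]
  show "continuous_on S (\<lambda>x. lower (f x) \<alpha>)" "continuous_on S (\<lambda>x. upper (f x) \<alpha>)"
    by simp_all
qed

section \<open>Integrals of continuous functions\<close>

lemma endpoints_sum_scaleR:
  fixes n :: nat
  assumes "\<alpha> \<in> {0..1}" "\<And>i. i < n \<Longrightarrow> 0 \<le> c i"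
  shows "lower (\<Sum>i<n. c i *\<^sub>R u i) \<alpha> = (\<Sum>i<n. c i * lower (u i) \<alpha>)"
    and "upper (\<Sum>i<n. c i *\<^sub>R u i) \<alpha> = (\<Sum>i<n. c i * upper (u i) \<alpha>)"
  using assms by (induction n) (simp_all add: endpoints_add endpoints_scaleR zero_fuzzy_number_def)

text \<open>On one cell the error is the integral of \<open>g (\<xi> i) - g y\<close>, at most e
  times the length, and the cells add up by induction. The conjunct \<open>x 0 \<le> x n\<close> is
  carried along so that the integral can be split at \<open>x n\<close>. The bound involves g only
  through e, which later makes it uniform in the level.\<close>

lemma riemann_sum_error:
  fixes g :: "real \<Rightarrow> real"
  assumes "continuous_on {x 0..x n} g" "\<And>i. i < n \<Longrightarrow> x i \<le> x (Suc i)"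
    and "\<And>i y. i < n \<Longrightarrow> y \<in> {x i..x (Suc i)} \<Longrightarrow> \<bar>g (\<xi> i) - g y\<bar> \<le> e"
  shows "x 0 \<le> x n \<and> \<bar>(\<Sum>i<n. (x (Suc i) - x i) * g (\<xi> i)) - integral {x 0..x n} g\<bar>
    \<le> e * (x n - x 0)"
  using assms
proof (induction n)
  case (Suc n)
  have le: "x n \<le> x (Suc n)" using Suc.prems by simp
  have IH: "x 0 \<le> x n \<and> \<bar>(\<Sum>i<n. (x (Suc i) - x i) * g (\<xi> i)) - integral {x 0..x n} g\<bar>
    \<le> e * (x n - x 0)"
  proof (rule Suc.IH)
    show "continuous_on {x 0..x n} g" by (rule continuous_on_subset[OF Suc.prems(1)]) (use le in auto)
  qed (use Suc.prems in auto)
  have int: "g integrable_on {x 0..x (Suc n)}"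
    using Suc.prems(1) by (rule integrable_continuous_interval)
  have int2: "g integrable_on {x n..x (Suc n)}"
    by (rule integrable_on_subinterval[OF int]) (use IH in auto)
  have split: "integral {x 0..x n} g + integral {x n..x (Suc n)} g = integral {x 0..x (Suc n)} g"
    using IH le int by (intro Henstock_Kurzweil_Integration.integral_combine) auto
  have "integral {x n..x (Suc n)} (\<lambda>y. g (\<xi> n) - g y)
      = (x (Suc n) - x n) * g (\<xi> n) - integral {x n..x (Suc n)} g"
    using int2 le by (subst Henstock_Kurzweil_Integration.integral_diff) auto
  moreover have "norm (integral {x n..x (Suc n)} (\<lambda>y. g (\<xi> n) - g y)) \<le> e * (x (Suc n) - x n)"
  proof (rule integral_bound[OF le])
    show "continuous_on {x n..x (Suc n)} (\<lambda>y. g (\<xi> n) - g y)"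
      by (intro continuous_intros continuous_on_subset[OF Suc.prems(1)]) (use IH in auto)
  qed (use Suc.prems(3) in auto)
  ultimately show ?case using IH le split by (auto simp: algebra_simps)
qed simp

text \<open>Supplies an actual Riemann sum, without which an estimate for all fine partitions could
  hold vacuously. The witness is the equidistant partition with left tags; for a = b it is n = 0,
  since cells must have positive length.\<close>

lemma ex_tagged_partition:
  fixes a b \<delta> :: real
  assumes "a \<le> b" "\<delta> > 0"
  shows "\<exists>(n::nat) x \<xi>. x 0 = a \<and> x n = b \<and>
    (\<forall>i<n. x i < x (Suc i) \<and> x (Suc i) - x i < \<delta> \<and> \<xi> i \<in> {x i..x (Suc i)})"
proof (cases "a = b")
  case True
  then show ?thesis by (intro exI[of _ 0] exI[of _ "\<lambda>_. a"]) simp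
next
  case False
  then have ab: "b - a > 0" using assms(1) by simp
  obtain n :: nat where n: "(b - a) / \<delta> < real n" using reals_Archimedean2 by blast
  then have n0: "real n > 0" using ab assms(2) by (meson divide_pos_pos less_trans)
  define h where "h = (b - a) / real n"
  have h: "0 < h" "h < \<delta>" using n n0 ab assms(2) by (simp_all add: h_def field_simps)
  define x where "x i = a + real i * h" for i :: nat
  have "x (Suc i) = x i + h" for i by (simp add: x_def algebra_simps)
  moreover have "x 0 = a" "x n = b" using n0 by (simp_all add: x_def h_def)
  ultimately show ?thesis using h by (intro exI[of _ n] exI[of _ x]) simp
qed

text \<open>Riemann sums approximate the endpoint integrals uniformly in the level. Being fuzzy
  numbers, they force the endpoint integrals to be the endpoints of a fuzzy number I, and the same
  estimate shows that I is the fuzzy Riemann integral.\<close>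

lemma continuous_fuzzy_integral:
  fixes f :: "real \<Rightarrow> fuzzy_number"
  assumes ab: "a \<le> b" and f: "continuous_on {a..b} f" and \<alpha>: "\<alpha> \<in> {0..1}"
  shows "lower (fuzzy_integral a b f) \<alpha> = integral {a..b} (\<lambda>x. lower (f x) \<alpha>)"
    and "upper (fuzzy_integral a b f) \<alpha> = integral {a..b} (\<lambda>x. upper (f x) \<alpha>)"
proof -
  define l where "l \<alpha> = integral {a..b} (\<lambda>x. lower (f x) \<alpha>)" for \<alpha>
  define r where "r \<alpha> = integral {a..b} (\<lambda>x. upper (f x) \<alpha>)" for \<alpha>
  define tagged where "tagged \<delta> n x \<xi> \<longleftrightarrow> x 0 = a \<and> x n = b \<and>
      (\<forall>i<n. x i < x (Suc i) \<and> x (Suc i) - x i < \<delta> \<and> \<xi> i \<in> {x i..x (Suc i)})"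
    for \<delta> and n :: nat and x \<xi> :: "nat \<Rightarrow> real"
  define RS where "RS n x \<xi> = (\<Sum>i<n. (x (Suc i) - x i) *\<^sub>R f (\<xi> i))"
    for n :: nat and x \<xi> :: "nat \<Rightarrow> real"
  have fine: "\<exists>\<delta>>0. \<forall>n x \<xi>. tagged \<delta> n x \<xi> \<longrightarrow>
      (\<forall>\<alpha>\<in>{0..1}. \<bar>lower (RS n x \<xi>) \<alpha> - l \<alpha>\<bar> \<le> e \<and> \<bar>upper (RS n x \<xi>) \<alpha> - r \<alpha>\<bar> \<le> e)"
    if "e > 0" for e
  proof -
    \<comment> \<open>Adding 1 to the length avoids division by zero when a = b.\<close>
    define e' where "e' = e / (b - a + 1)"
    have e': "e' > 0" "e' * (b - a) \<le> e" using that ab by (auto simp: e'_def field_simps)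
    \<comment> \<open>Uniform continuity is taken with respect to D, so one \<delta> serves both
      endpoints at all levels.\<close>
    have "uniformly_continuous_on {a..b} f" using f by (simp add: compact_uniformly_continuous)
    then obtain \<delta> where \<delta>: "\<delta> > 0"
      "\<And>y z. y \<in> {a..b} \<Longrightarrow> z \<in> {a..b} \<Longrightarrow> dist z y < \<delta> \<Longrightarrow> dist (f z) (f y) < e'"
      using e'(1) unfolding uniformly_continuous_on_def by metis
    have "\<bar>lower (RS n x \<xi>) \<alpha> - l \<alpha>\<bar> \<le> e \<and> \<bar>upper (RS n x \<xi>) \<alpha> - r \<alpha>\<bar> \<le> e"
      if tg: "tagged \<delta> n x \<xi>" and \<alpha>: "\<alpha> \<in> {0..1}" for n x \<xi> \<alpha>
    proof -
      have ends: "x 0 = a" "x n = b" using tg by (auto simp: tagged_def)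
      have incr: "x i \<le> x j" if "i \<le> j" "j \<le> n" for i j
        using that
      proof (induction j)
        case (Suc j)
        then have "x j < x (Suc j)" using tg by (auto simp: tagged_def)
        then show ?case using Suc by (cases "i = Suc j") auto
      qed simp
      have close: "dist (f (\<xi> i)) (f y) \<le> e'" if "i < n" "y \<in> {x i..x (Suc i)}" for i y
      proof -
        have i: "\<xi> i \<in> {x i..x (Suc i)}" "x (Suc i) - x i < \<delta>" using tg that by (auto simp: tagged_def)
        have "a \<le> x i" "x (Suc i) \<le> b" using incr[of 0 i] incr[of "Suc i" n] ends that by auto
        then have "dist (f (\<xi> i)) (f y) < e'"
          using i that by (intro \<delta>(2)) (auto simp: dist_real_def)
        then show ?thesis by simp
      qed
      have pos: "0 \<le> x (Suc i) - x i" if "i < n" for i using incr[of i "Suc i"] that by simp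
      note le = abs_endpoint_diff_le_dist[OF \<alpha>, THEN order_trans]
      have "\<bar>(\<Sum>i<n. (x (Suc i) - x i) * lower (f (\<xi> i)) \<alpha>)
          - integral {x 0..x n} (\<lambda>y. lower (f y) \<alpha>)\<bar> \<le> e' * (x n - x 0)"
        by (rule riemann_sum_error[THEN conjunct2])
          (use continuous_on_endpoints[OF f \<alpha>] ends pos close in \<open>auto intro!: le\<close>)
      moreover have "\<bar>(\<Sum>i<n. (x (Suc i) - x i) * upper (f (\<xi> i)) \<alpha>)
          - integral {x 0..x n} (\<lambda>y. upper (f y) \<alpha>)\<bar> \<le> e' * (x n - x 0)"
        by (rule riemann_sum_error[THEN conjunct2])
          (use continuous_on_endpoints[OF f \<alpha>] ends pos close in \<open>auto intro!: le\<close>)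
      moreover have "lower (RS n x \<xi>) \<alpha> = (\<Sum>i<n. (x (Suc i) - x i) * lower (f (\<xi> i)) \<alpha>)"
        "upper (RS n x \<xi>) \<alpha> = (\<Sum>i<n. (x (Suc i) - x i) * upper (f (\<xi> i)) \<alpha>)"
        unfolding RS_def using pos by (simp_all add: endpoints_sum_scaleR[OF \<alpha>])
      ultimately show ?thesis using e'(2) ends by (auto simp: l_def r_def)
    qed
    then show ?thesis using \<delta>(1) by blast
  qed
  have "\<exists>u. \<forall>\<alpha>\<in>{0..1}. \<bar>lower u \<alpha> - l \<alpha>\<bar> \<le> e \<and> \<bar>upper u \<alpha> - r \<alpha>\<bar> \<le> e" if "e > 0" for e
  proof -
    obtain \<delta> where \<delta>: "\<delta> > 0" "\<And>n x \<xi>. tagged \<delta> n x \<xi> \<Longrightarrow>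
      (\<forall>\<alpha>\<in>{0..1}. \<bar>lower (RS n x \<xi>) \<alpha> - l \<alpha>\<bar> \<le> e \<and> \<bar>upper (RS n x \<xi>) \<alpha> - r \<alpha>\<bar> \<le> e)"
      using fine[OF \<open>e > 0\<close>] by blast
    obtain n x \<xi> where "tagged \<delta> n x \<xi>"
      unfolding tagged_def using ex_tagged_partition[OF ab \<delta>(1)] by blast
    then show ?thesis using \<delta>(2) by blast
  qed
  from ex_fuzzy_number_uniform_limit[OF this]
  obtain I where I: "\<And>\<alpha>. \<alpha> \<in> {0..1} \<Longrightarrow> lower I \<alpha> = l \<alpha> \<and> upper I \<alpha> = r \<alpha>" by blast
  have "\<exists>\<delta>>0. \<forall>n x \<xi>. tagged \<delta> n x \<xi> \<longrightarrow> dist (RS n x \<xi>) I < e" if "e > 0" for e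
  proof -
    \<comment> \<open>The supremum in D only yields a non-strict bound; halving e restores the
      strict inequality that the integral demands.\<close>
    obtain \<delta> where \<delta>: "\<delta> > 0" "\<And>n x \<xi>. tagged \<delta> n x \<xi> \<Longrightarrow>
      (\<forall>\<alpha>\<in>{0..1}. \<bar>lower (RS n x \<xi>) \<alpha> - l \<alpha>\<bar> \<le> e/2 \<and> \<bar>upper (RS n x \<xi>) \<alpha> - r \<alpha>\<bar> \<le> e/2)"
      using fine[of "e/2"] \<open>e > 0\<close> by auto
    have "dist (RS n x \<xi>) I \<le> e/2" if "tagged \<delta> n x \<xi>" for n x \<xi>
      by (rule dist_fuzzy_number_leI) (use \<delta>(2)[OF that] I in auto)
    then show ?thesis using \<delta>(1) \<open>e > 0\<close> by (intro exI[of _ \<delta>]) force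
  qed
  then have "has_fuzzy_integral f I a b"
    unfolding has_fuzzy_integral_def tagged_def RS_def by blast
  then have "fuzzy_integral a b f = I" by (rule fuzzy_integral_eqI[OF ab])
  then show "lower (fuzzy_integral a b f) \<alpha> = integral {a..b} (\<lambda>x. lower (f x) \<alpha>)"
    "upper (fuzzy_integral a b f) \<alpha> = integral {a..b} (\<lambda>x. upper (f x) \<alpha>)"
    using I[OF \<alpha>] by (simp_all add: l_def r_def)
qed

section \<open>Continuity of the integral function\<close>

lemma integral_diff_le:
  fixes g :: "real \<Rightarrow> real"
  assumes "0 \<le> t" "t \<le> t'" "continuous_on {0..t'} g" "\<And>x. x \<in> {0..t'} \<Longrightarrow> \<bar>g x\<bar> \<le> M"
  shows "\<bar>integral {0..t} g - integral {0..t'} g\<bar> \<le> M * (t' - t)"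
proof -
  have "integral {0..t} g + integral {t..t'} g = integral {0..t'} g"
    using assms by (intro Henstock_Kurzweil_Integration.integral_combine integrable_continuous_interval) auto
  moreover have "norm (integral {t..t'} g) \<le> M * (t' - t)"
    using assms by (intro integral_bound) (auto intro: continuous_on_subset)
  ultimately show ?thesis by auto
qed

text \<open>On [0,T] the distance of f from \<open>crisp 0\<close> is bounded, which makes the
  integral function Lipschitz there. Its continuity is what allows the integrals in the Cesaro means
  to be computed endpointwise.\<close>

lemma continuous_on_integral_function:
  assumes f: "continuous_on {0..} f"
  shows "continuous_on {0..} (integral_function f)"
proof -
  have "continuous_on {0..T} (integral_function f)" for T :: real
  proof -
    have fT: "continuous_on {0..t} f" for t by (rule continuous_on_subset[OF f]) auto
    have "compact (f ` {0..T})" by (intro compact_continuous_image fT) simp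
    then obtain M where "\<forall>u\<in>f ` {0..T}. dist (crisp 0) u \<le> M"
      using compact_imp_bounded bounded_any_center by metis
    then have M: "dist (f x) (crisp 0) \<le> M" if "x \<in> {0..T}" for x
      using that by (auto simp: dist_commute)
    have ends: "\<bar>lower (f x) \<alpha>\<bar> \<le> M" "\<bar>upper (f x) \<alpha>\<bar> \<le> M" if "x \<in> {0..T}" "\<alpha> \<in> {0..1}" for x \<alpha>
      using abs_endpoint_diff_le_dist[OF that(2), of "f x" "crisp 0"] M[OF that(1)] that(2) by auto
    have *: "dist (integral_function f t) (integral_function f t') \<le> M * (t' - t)"
      if t: "0 \<le> t" "t \<le> t'" "t' \<le> T" for t t'
    proof (rule dist_fuzzy_number_leI)
      fix \<alpha> :: real assume \<alpha>: "\<alpha> \<in> {0..1}"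
      show "\<bar>lower (integral_function f t) \<alpha> - lower (integral_function f t') \<alpha>\<bar> \<le> M * (t' - t)"
        using t by (simp add: integral_function_def continuous_fuzzy_integral[OF _ fT \<alpha>])
          (intro integral_diff_le continuous_on_endpoints[OF fT \<alpha>] ends \<alpha>, auto)
      show "\<bar>upper (integral_function f t) \<alpha> - upper (integral_function f t') \<alpha>\<bar> \<le> M * (t' - t)"
        using t by (simp add: integral_function_def continuous_fuzzy_integral[OF _ fT \<alpha>])
          (intro integral_diff_le continuous_on_endpoints[OF fT \<alpha>] ends \<alpha>, auto)
    qed
    have "M-lipschitz_on {0..T} (integral_function f)" if "0 \<le> T"
    proof (rule lipschitz_onI)
      show "dist (integral_function f x) (integral_function f y) \<le> M * dist x y"
        if "x \<in> {0..T}" "y \<in> {0..T}" for x y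
        using that *[of x y] *[of y x] by (cases "x \<le> y") (auto simp: dist_real_def dist_commute)
      show "0 \<le> M" using M[of 0] \<open>0 \<le> T\<close> order_trans[OF zero_le_dist] by simp
    qed
    then show ?thesis
      by (cases "0 \<le> T") (auto intro: lipschitz_on_continuous_on)
  qed
  \<comment> \<open>Half-open intervals are relatively open in the half-line, so continuity within
    them is continuity within the half-line.\<close>
  then have T: "continuous_on {0..<T} (integral_function f)" for T :: real
    by (rule continuous_on_subset[of "{0..T}"]) auto
  show ?thesis
    unfolding continuous_on_eq_continuous_within
  proof
    fix t :: real assume t: "t \<in> {0..}"
    have "continuous (at t within {0..<t+1}) (integral_function f)"
      using T[of "t+1"] t unfolding continuous_on_eq_continuous_within by simp
    moreover have "at t within {0..<t+1} = at t within {0..}"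
      by (rule at_within_nhd[of _ "{..<t+1}"]) auto
    ultimately show "continuous (at t within {0..}) (integral_function f)" by simp
  qed
qed

section \<open>The Tauberian argument\<close>

text \<open>Multiplying the two mean estimates by t and ct and subtracting shows that the integral
  over [t, ct] differs from l(c-1)t by at most \<eta>(c+1)t. The relation between \<eta> and
  \<epsilon> makes this \<epsilon> times the interval length, so the average of g is within
  \<epsilon> of l; a constant bound m for g also bounds that average.\<close>

lemma integral_average_bounds:
  fixes g :: "real \<Rightarrow> real"
  assumes c: "c > 1" and t: "t > 0" and g: "continuous_on {0..} g"
    and est: "\<bar>integral {0..t} g / t - l\<bar> \<le> \<eta>" "\<bar>integral {0..c * t} g / (c * t) - l\<bar> \<le> \<eta>"
    and \<eta>: "\<eta> * (c + 1) = \<epsilon> * (c - 1)"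
  shows "(\<And>x. x \<in> {t..c * t} \<Longrightarrow> m \<le> g x) \<Longrightarrow> m \<le> l + \<epsilon>"
    and "(\<And>x. x \<in> {t..c * t} \<Longrightarrow> g x \<le> m) \<Longrightarrow> l - \<epsilon> \<le> m"
proof -
  have ct: "t \<le> c * t" "0 < (c - 1) * t" using c t by auto
  have int: "g integrable_on {a..b}" if "0 \<le> a" for a b
    by (rule integrable_continuous_interval, rule continuous_on_subset[OF g]) (use that in auto)
  have split: "integral {0..t} g + integral {t..c * t} g = integral {0..c * t} g"
    using ct t int by (intro Henstock_Kurzweil_Integration.integral_combine) auto
  have "\<bar>integral {0..t} g - l * t\<bar> \<le> \<eta> * t"
    using est(1) t by (simp add: abs_le_iff field_simps)
  moreover have "\<bar>integral {0..c * t} g - l * (c * t)\<bar> \<le> \<eta> * (c * t)"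
    using est(2) t c by (simp add: abs_le_iff field_simps)
  moreover have "\<eta> * t + \<eta> * (c * t) = \<epsilon> * ((c - 1) * t)"
    using \<eta> by algebra
  moreover have "integral {t..c * t} g - l * ((c - 1) * t) =
      (integral {0..c * t} g - l * (c * t)) - (integral {0..t} g - l * t)"
    using split by (simp add: algebra_simps)
  ultimately have J: "\<bar>integral {t..c * t} g - l * ((c - 1) * t)\<bar> \<le> \<epsilon> * ((c - 1) * t)"
    by linarith
  have const: "integral {t..c * t} (\<lambda>_. m) = m * ((c - 1) * t)" using ct by (simp add: algebra_simps)
  show "m \<le> l + \<epsilon>" if "\<And>x. x \<in> {t..c * t} \<Longrightarrow> m \<le> g x"
  proof -
    have "m * ((c - 1) * t) \<le> integral {t..c * t} g"
      unfolding const[symmetric] using that int t by (intro integral_le) auto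
    then have "m * ((c - 1) * t) \<le> (l + \<epsilon>) * ((c - 1) * t)"
      using J by (simp add: abs_le_iff algebra_simps)
    then show ?thesis using ct(2) by (rule mult_right_le_imp_le)
  qed
  show "l - \<epsilon> \<le> m" if "\<And>x. x \<in> {t..c * t} \<Longrightarrow> g x \<le> m"
  proof -
    have "integral {t..c * t} g \<le> m * ((c - 1) * t)"
      unfolding const[symmetric] using that int t by (intro integral_le) auto
    then have "(l - \<epsilon>) * ((c - 1) * t) \<le> m * ((c - 1) * t)"
      using J by (simp add: abs_le_iff algebra_simps)
    then show ?thesis using ct(2) by (rule mult_right_le_imp_le)
  qed
qed

text \<open>All constants are given in advance for one real function, so one threshold works for
  both endpoints at every level. One \<epsilon> is lost in slow decrease and one in the average.
  Starting at \<open>c * T\<close> keeps the backward interval [t/c, t] beyond T.\<close>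

lemma tauberian_bound:
  fixes g :: "real \<Rightarrow> real"
  assumes c: "c > 1" and T: "T > 0" and g: "continuous_on {0..} g" and "\<epsilon> \<ge> 0"
    and est: "\<And>t. t \<ge> T \<Longrightarrow> \<bar>integral {0..t} g / t - l\<bar> \<le> \<eta>"
    and \<eta>: "\<eta> * (c + 1) = \<epsilon> * (c - 1)"
    and slow: "\<And>t x. T \<le> t \<Longrightarrow> t < x \<Longrightarrow> x \<le> c * t \<Longrightarrow> g t - \<epsilon> \<le> g x"
    and t: "c * T \<le> t"
  shows "\<bar>g t - l\<bar> \<le> 2 * \<epsilon>"
proof -
  \<comment> \<open>The windows of integration contain the point t itself, where the strict
    hypothesis says nothing; there \<epsilon> \<ge> 0 suffices.\<close>
  have slow': "g t - \<epsilon> \<le> g x" if "T \<le> t" "t \<le> x" "x \<le> c * t" for t x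
    using slow[of t x] that \<open>\<epsilon> \<ge> 0\<close> by (cases "t = x") auto
  have "T \<le> c * T" using c T by auto
  then have Tt: "T \<le> t" using t by simp
  then have tct: "t \<le> c * t" using c T by auto
  then have Tct: "T \<le> c * t" using Tt by simp
  have "g t - \<epsilon> \<le> l + \<epsilon>"
    by (rule integral_average_bounds(1)[OF c _ g est est \<eta>, of t])
      (use slow' Tt T tct Tct in auto)
  moreover have "l - \<epsilon> \<le> g t + \<epsilon>"
  \<comment> \<open>Slow decrease is one-sided, so it bounds g from above by g t + \<epsilon> only
    before t. The window starting at t/c ends at t, and each of its points reaches t within the
    factor c.\<close>
  proof (rule integral_average_bounds(2)[OF c _ g est est \<eta>, of "t / c"])
    show Ttc: "T \<le> t / c" using t c by (simp add: field_simps)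
    then show "0 < t / c" using T by simp
    show "T \<le> c * (t / c)" using Tt c by simp
    show "g x \<le> g t + \<epsilon>" if x: "x \<in> {t / c..c * (t / c)}" for x
    proof -
      have "t \<le> c * x" using x c by (simp add: field_simps)
      then show ?thesis using slow'[of x t] x c Ttc by auto
    qed
  qed
  ultimately show ?thesis by auto
qed

section \<open>From uniform bounds at all levels to convergence in the metric\<close>

theorem corollary3p10:
  fixes f :: "real \<Rightarrow> fuzzy_number" and L :: fuzzy_number
  assumes "continuous_on {0..} f"
    and "cesaro_summable_to f L"
    and "slowly_decreasing (integral_function f)"
  shows "integral_converges_to f L"
proof -
  let ?s = "integral_function f"
  have s: "continuous_on {0..} ?s" by (rule continuous_on_integral_function[OF assms(1)])
  have cesaro: "lower (cesaro_mean f t) \<alpha> = integral {0..t} (\<lambda>x. lower (?s x) \<alpha>) / t"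
    "upper (cesaro_mean f t) \<alpha> = integral {0..t} (\<lambda>x. upper (?s x) \<alpha>) / t"
    if "t > 0" "\<alpha> \<in> {0..1}" for t \<alpha>
  proof -
    have "continuous_on {0..t} ?s" by (rule continuous_on_subset[OF s]) auto
    then show "lower (cesaro_mean f t) \<alpha> = integral {0..t} (\<lambda>x. lower (?s x) \<alpha>) / t"
      "upper (cesaro_mean f t) \<alpha> = integral {0..t} (\<lambda>x. upper (?s x) \<alpha>) / t"
      using that by (simp_all add: cesaro_mean_def endpoints_scaleR continuous_fuzzy_integral)
  qed
  have "\<forall>\<^sub>F t in at_top. dist (?s t) L < e" if "e > 0" for e
  proof -
    \<comment> \<open>The final estimate is 2\<epsilon>, so a third of e leaves a strict
      inequality.\<close>
    define \<epsilon> where "\<epsilon> = e / 3"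
    have \<epsilon>: "\<epsilon> > 0" using that by (simp add: \<epsilon>_def)
    obtain t0 c where t0: "t0 \<ge> 0" "c > 1"
      and slow: "\<And>t x. t0 < t \<Longrightarrow> t < x \<Longrightarrow> x \<le> c * t \<Longrightarrow> ?s x \<ge> ?s t + crisp (- \<epsilon>)"
      using assms(3) \<epsilon> unfolding slowly_decreasing_def by metis
    \<comment> \<open>Solves for \<eta> the relation under which the averages over [t, ct] have
      error \<epsilon>.\<close>
    define \<eta> where "\<eta> = \<epsilon> * (c - 1) / (c + 1)"
    have \<eta>: "\<eta> > 0" "\<eta> * (c + 1) = \<epsilon> * (c - 1)" using \<epsilon> t0(2) by (auto simp: \<eta>_def)
    have "\<forall>\<^sub>F t in at_top. dist (cesaro_mean f t) L < \<eta>"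
      using assms(2) \<eta>(1) unfolding cesaro_summable_to_def by (rule tendstoD)
    then obtain T1 where T1: "\<And>t. t \<ge> T1 \<Longrightarrow> dist (cesaro_mean f t) L < \<eta>"
      unfolding eventually_at_top_linorder by blast
    \<comment> \<open>The term \<open>t0 + 1\<close> makes T positive and strictly larger than
      \<open>t0\<close>, as the strict condition in slow decrease requires.\<close>
    define T where "T = max T1 (t0 + 1)"
    have T: "T > 0" "T \<ge> T1" "T > t0" using t0(1) by (auto simp: T_def)
    have "dist (?s t) L < e" if t: "t \<ge> c * T" for t
    proof -
      have "dist (?s t) L \<le> 2 * \<epsilon>"
      proof (rule dist_fuzzy_number_leI)
        \<comment> \<open>The constants c, \<eta> and T were fixed before \<alpha>, so the bound
          passes to the supremum over levels that defines D.\<close>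
        fix \<alpha> :: real assume \<alpha>: "\<alpha> \<in> {0..1}"
        have est: "\<bar>integral {0..t} (\<lambda>x. lower (?s x) \<alpha>) / t - lower L \<alpha>\<bar> \<le> \<eta>"
          "\<bar>integral {0..t} (\<lambda>x. upper (?s x) \<alpha>) / t - upper L \<alpha>\<bar> \<le> \<eta>" if "t \<ge> T" for t
          using abs_endpoint_diff_le_dist[OF \<alpha>, of "cesaro_mean f t" L] T1[of t] that T
          by (simp_all add: cesaro[OF _ \<alpha>])
        \<comment> \<open>Adding \<open>crisp (- \<epsilon>)\<close> shifts both endpoints by
          -\<epsilon>, so the fuzzy order gives slow decrease of both endpoint functions with the
          same constants.\<close>
        have slow': "lower (?s t) \<alpha> - \<epsilon> \<le> lower (?s x) \<alpha>" "upper (?s t) \<alpha> - \<epsilon> \<le> upper (?s x) \<alpha>"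
          if "T \<le> t" "t < x" "x \<le> c * t" for t x
          using slow[of t x] that T \<alpha> by (auto simp: less_eq_fuzzy_number_def endpoints_add)
        show "\<bar>lower (?s t) \<alpha> - lower L \<alpha>\<bar> \<le> 2 * \<epsilon>"
          by (rule tauberian_bound[OF t0(2) T(1) continuous_on_endpoints(1)[OF s \<alpha>] _ est(1) \<eta>(2) slow'(1) t])
            (use \<epsilon> in auto)
        show "\<bar>upper (?s t) \<alpha> - upper L \<alpha>\<bar> \<le> 2 * \<epsilon>"
          by (rule tauberian_bound[OF t0(2) T(1) continuous_on_endpoints(2)[OF s \<alpha>] _ est(2) \<eta>(2) slow'(2) t])
            (use \<epsilon> in auto)
      qed
      then show ?thesis using that \<open>e > 0\<close> by (simp add: \<epsilon>_def)
    qed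
    then show ?thesis unfolding eventually_at_top_linorder by blast
  qed
  then show ?thesis unfolding integral_converges_to_def by (rule tendstoI)
qed

end
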